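(* Let $D$ and $k$ be integers. There exists an infinite family of $n$-vertex graphs $G$ with unit edge lengths and minimum degree at least $D$ such that for every $(k,1)$-contraction $C$ of $G$, the contracted graph $G/C$ has at least $n/((k+1)D)$ vertices.
   Context: For $C\subseteq E$, $\ell_C$ equals $0$ on $C$ and $1$ elsewhere. A $(k,1)$-contraction is a set $C\subseteq E$ with $\mathrm{dist}_{\ell_C}(u,v)\ge\mathrm{dist}_\ell(u,v)/k-1$ for all vertices $u,v$. $G/C$ is the graph obtained from $G$ by contracting the edges of $C$ (its vertices are the connected components of $(V,C)$), deleting loops and merging parallel edges. *)

theory Defs
  imports "HOL-Library.Extended_Real"
begin

datatype 'v ugraph = Ugraph (verts: "'v set") (edges: "'v set set")

definition simple_graph :: "'v ugraph \<Rightarrow> bool" where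
  "simple_graph G \<longleftrightarrow> finite (verts G) \<and> verts G \<noteq> {} \<and>
     (\<forall>e\<in>edges G. e \<subseteq> verts G \<and> card e = 2)"

definition degree :: "'v ugraph \<Rightarrow> 'v \<Rightarrow> nat" where
  "degree G v = card {e \<in> edges G. v \<in> e}"

definition min_degree :: "'v ugraph \<Rightarrow> nat" where
  "min_degree G = Min (degree G ` verts G)"

fun walk_edges :: "'v list \<Rightarrow> 'v set list" where
  "walk_edges (u # v # p) = {u, v} # walk_edges (v # p)"
| "walk_edges _ = []"

definition walks :: "'v ugraph \<Rightarrow> 'v \<Rightarrow> 'v \<Rightarrow> 'v list set" where
  "walks G u v = {p. p \<noteq> [] \<and> hd p = u \<and> last p = v \<and>
     set p \<subseteq> verts G \<and> set (walk_edges p) \<subseteq> edges G}"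

definition walk_length :: "('v set \<Rightarrow> real) \<Rightarrow> 'v list \<Rightarrow> real" where
  "walk_length l p = (\<Sum>e\<leftarrow>walk_edges p. l e)"

text \<open>Shortest-path distance; it is \<open>\<infinity>\<close> between vertices in different
  components. For nonnegative lengths the infimum over walks is the minimum over paths.\<close>

definition gdist :: "'v ugraph \<Rightarrow> ('v set \<Rightarrow> real) \<Rightarrow> 'v \<Rightarrow> 'v \<Rightarrow> ereal" where
  "gdist G l u v = (INF p\<in>walks G u v. ereal (walk_length l p))"

definition unit_length :: "'v set \<Rightarrow> real" where
  "unit_length e = 1"

definition contracted_length :: "'v set set \<Rightarrow> 'v set \<Rightarrow> real" where
  "contracted_length C e = (if e \<in> C then 0 else 1)"

text \<open>\<open>contraction_k1 G l k C\<close>: \<open>C\<close> is a \<open>(k,1)\<close>-contraction of \<open>G\<close> with edge lengths \<open>l\<close>.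
  For vertices at distance \<open>\<infinity>\<close> and \<open>k > 0\<close> both sides of the inequality are \<open>\<infinity>\<close>.\<close>

definition contraction_k1 ::
    "'v ugraph \<Rightarrow> ('v set \<Rightarrow> real) \<Rightarrow> nat \<Rightarrow> 'v set set \<Rightarrow> bool" where
  "contraction_k1 G l k C \<longleftrightarrow> C \<subseteq> edges G \<and>
     (\<forall>u\<in>verts G. \<forall>v\<in>verts G.
        gdist G (contracted_length C) u v \<ge> gdist G l u v / ereal (real k) - 1)"

definition component :: "'v ugraph \<Rightarrow> 'v \<Rightarrow> 'v set" where
  "component G v = {w. walks G v w \<noteq> {}}"

definition components :: "'v ugraph \<Rightarrow> 'v set set" where
  "components G = component G ` verts G"

definition contract :: "'v ugraph \<Rightarrow> 'v set set \<Rightarrow> 'v set ugraph" where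
  "contract G C = (let K = components (Ugraph (verts G) C) in
     Ugraph K {{A, B} | A B. A \<in> K \<and> B \<in> K \<and> A \<noteq> B \<and>
                              (\<exists>a\<in>A. \<exists>b\<in>B. {a, b} \<in> edges G)})"

end

theory Submission
  imports Defs
begin

text \<open>
  Take a path of \<open>m\<close> consecutive layers of \<open>D\<close> vertices each and join any two distinct vertices
  whose layers differ by at most one. All \<open>D\<close> vertices of a neighbouring layer are adjacent to a
  given vertex. The vertices merged by a \<open>(k,1)\<close>-contraction are at contracted distance \<open>0\<close>, hence
  at distance at most \<open>k\<close> in \<open>G\<close>. As an edge moves by at most one layer, they occupy at most
  \<open>k + 1\<close> layers, that is, at most \<open>(k + 1) D\<close> vertices.
\<close>

text \<open>Together with the converse below, this trades walks for reachability under a relation,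
  so that reversing and joining walks becomes symmetry and transitivity of the closure instead of
  list manipulation.\<close>

lemma walk_imp_rtrancl:
  assumes "p \<noteq> []" "set (walk_edges p) \<subseteq> C"
  shows "(hd p, last p) \<in> {(a, b). {a, b} \<in> C}\<^sup>*"
  using assms
proof (induction p rule: walk_edges.induct)
  case (1 u v p)
  then have "(v, last (v # p)) \<in> {(a, b). {a, b} \<in> C}\<^sup>*" "{u, v} \<in> C"
    by auto
  then show ?case
    by (auto intro: converse_rtrancl_into_rtrancl)
qed auto

lemma rtrancl_imp_walk:
  assumes "(u, v) \<in> {(a, b). {a, b} \<in> C}\<^sup>*" "\<Union>C \<subseteq> V" "v \<in> V"
  shows "walks (Ugraph V C) u v \<noteq> {}"
  using assms(1)
proof (induction rule: converse_rtrancl_induct)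
  \<comment> \<open>The closure is reflexive at every element, but the one-vertex walk exists only
    inside \<open>V\<close>; this is where \<open>v \<in> V\<close> enters.\<close>
  case base
  have "[v] \<in> walks (Ugraph V C) v v"
    using assms(3) by (simp add: walks_def)
  then show ?case by blast
next
  case (step a b)
  then obtain p where p: "p \<in> walks (Ugraph V C) b v" by blast
  then obtain q where "p = b # q"
    by (cases p) (auto simp: walks_def)
  with p step(1) assms(2) have "a # p \<in> walks (Ugraph V C) a v"
    by (auto simp: walks_def)
  then show ?case by blast
qed

text \<open>Adjacency is symmetric, so one can go from \<open>x\<close> back to \<open>v\<close> and
  from there on to \<open>y\<close>.\<close>

lemma component_walk:
  assumes "\<Union>C \<subseteq> V" "x \<in> component (Ugraph V C) v" "y \<in> component (Ugraph V C) v"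
  shows "walks (Ugraph V C) x y \<noteq> {}"
proof -
  let ?R = "{(a, b). {a, b} \<in> C}"
  have reach: "(v, w) \<in> ?R\<^sup>*" "w \<in> V" if w: "w \<in> component (Ugraph V C) v" for w
  proof -
    from w obtain p where "p \<in> walks (Ugraph V C) v w"
      by (auto simp: component_def)
    then have p: "p \<noteq> []" "hd p = v" "last p = w" "set p \<subseteq> V" "set (walk_edges p) \<subseteq> C"
      by (auto simp: walks_def)
    show "(v, w) \<in> ?R\<^sup>*"
      using walk_imp_rtrancl[OF p(1,5)] p(2,3) by simp
    show "w \<in> V"
      using p by (metis last_in_set subsetD)
  qed
  have "sym ?R"
    by (simp add: sym_def insert_commute)
  then have "(x, v) \<in> ?R\<^sup>*"
    using reach(1)[OF assms(2)] by (meson sym_rtrancl symD)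
  then have "(x, y) \<in> ?R\<^sup>*"
    using reach(1)[OF assms(3)] by (rule rtrancl_trans)
  then show ?thesis
    using assms(1) reach(2)[OF assms(3)] by (rule rtrancl_imp_walk)
qed

text \<open>A walk inside \<open>C\<close> is also a walk of \<open>G\<close>, and all its edges
  have contracted length 0.\<close>

lemma gdist_contracted_nonpos:
  assumes "C \<subseteq> edges G" "walks (Ugraph (verts G) C) u v \<noteq> {}"
  shows "gdist G (contracted_length C) u v \<le> 0"
proof -
  from assms(2) obtain p where p: "p \<in> walks (Ugraph (verts G) C) u v" by blast
  then have "p \<in> walks G u v"
    using assms(1) by (auto simp: walks_def)
  then have "gdist G (contracted_length C) u v \<le> ereal (walk_length (contracted_length C) p)"
    unfolding gdist_def by (rule INF_lower)
  also have "map (contracted_length C) (walk_edges p) = map (\<lambda>_. 0) (walk_edges p)"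
    using p unfolding map_eq_conv by (auto simp: walks_def contracted_length_def)
  then have "walk_length (contracted_length C) p = 0"
    unfolding walk_length_def by (metis sum_list_0)
  finally show ?thesis by (simp add: zero_ereal_def)
qed

text \<open>Triangle inequality along the walk: each edge costs 1 and changes \<open>f\<close> by at
  most 1. Later \<open>f\<close> is the layer number.\<close>

lemma walk_length_ge_potential:
  fixes f :: "'v \<Rightarrow> real"
  assumes "p \<noteq> []" "set (walk_edges p) \<subseteq> E"
    and "\<And>a b. {a, b} \<in> E \<Longrightarrow> \<bar>f a - f b\<bar> \<le> 1"
  shows "\<bar>f (hd p) - f (last p)\<bar> \<le> walk_length unit_length p"
  using assms(1,2)
proof (induction p rule: walk_edges.induct)
  case (1 u v p)
  then have "\<bar>f v - f (last (v # p))\<bar> \<le> walk_length unit_length (v # p)" "\<bar>f u - f v\<bar> \<le> 1"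
    using assms(3) by auto
  then show ?case
    by (auto simp: walk_length_def unit_length_def)
qed (auto simp: walk_length_def)

text \<open>Two vertices of one component have contracted distance at most 0, so the contraction
  inequality forces their distance \<open>d\<close> in \<open>G\<close> to satisfy
  \<open>d / k - 1 \<le> 0\<close>. The potential difference is a lower bound for
  \<open>d\<close>.\<close>

lemma contraction_component_potential:
  fixes f :: "'v \<Rightarrow> real"
  assumes "simple_graph G" "contraction_k1 G unit_length k C" "k \<ge> 1"
    and "\<And>a b. {a, b} \<in> edges G \<Longrightarrow> \<bar>f a - f b\<bar> \<le> 1"
    and "x \<in> component (Ugraph (verts G) C) v" "y \<in> component (Ugraph (verts G) C) v"
  shows "\<bar>f x - f y\<bar> \<le> k"
proof -
  have C: "C \<subseteq> edges G"
    using assms(2) by (simp add: contraction_k1_def)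
  then have "\<Union>C \<subseteq> verts G"
    using assms(1) by (auto simp: simple_graph_def)
  then have walk: "walks (Ugraph (verts G) C) x y \<noteq> {}"
    using assms(5,6) by (rule component_walk)
  then have xy: "x \<in> verts G" "y \<in> verts G"
    by (auto simp: walks_def)
  \<comment> \<open>Each walk is bounded separately, so no shortest walk has to be chosen.\<close>
  have "ereal \<bar>f x - f y\<bar> \<le> gdist G unit_length x y"
    unfolding gdist_def
  proof (intro INF_greatest)
    fix p assume "p \<in> walks G x y"
    then have "p \<noteq> []" "hd p = x" "last p = y" "set (walk_edges p) \<subseteq> edges G"
      by (simp_all add: walks_def)
    then show "ereal \<bar>f x - f y\<bar> \<le> ereal (walk_length unit_length p)"
      using walk_length_ge_potential[OF _ _ assms(4), of p] by simp
  qed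
  then have "ereal \<bar>f x - f y\<bar> / ereal (real k) \<le> gdist G unit_length x y / ereal (real k)"
    using assms(3) by (intro ereal_divide_right_mono) auto
  then have "ereal \<bar>f x - f y\<bar> / ereal (real k) - 1 \<le> gdist G unit_length x y / ereal (real k) - 1"
    by (intro ereal_minus_mono) auto
  also have "\<dots> \<le> gdist G (contracted_length C) x y"
    using assms(2) xy by (simp add: contraction_k1_def)
  also have "\<dots> \<le> 0"
    using C walk by (rule gdist_contracted_nonpos)
  finally have "\<bar>f x - f y\<bar> / k - 1 \<le> 0"
    using assms(3) by (simp add: zero_ereal_def one_ereal_def)
  then show ?thesis
    using assms(3) by (simp add: field_simps)
qed

text \<open>The vertices of the contracted graph are the components, which cover
  \<open>verts G\<close>; a union bound over them gives the estimate.\<close>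

lemma card_verts_le_contract:
  assumes "\<And>v. v \<in> verts G \<Longrightarrow> card (component (Ugraph (verts G) C) v) \<le> s"
  shows "card (verts G) \<le> card (verts (contract G C)) * s"
proof -
  let ?K = "components (Ugraph (verts G) C)"
  have "v \<in> component (Ugraph (verts G) C) v" if "v \<in> verts G" for v
  proof -
    have "[v] \<in> walks (Ugraph (verts G) C) v v"
      using that by (simp add: walks_def)
    then show ?thesis by (auto simp: component_def)
  qed
  moreover have "component (Ugraph (verts G) C) v \<subseteq> verts G" for v
    by (auto simp: component_def walks_def)
  ultimately have K: "\<Union>?K = verts G"
    by (auto simp: components_def)
  have "card (\<Union>?K) \<le> (\<Sum>A\<in>?K. card A)"
    by (rule card_Union_le_sum_card)
  also have "\<dots> \<le> card ?K * s"
    using assms by (intro sum_bounded_above[of _ _ s, simplified]) (auto simp: components_def)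
  finally show ?thesis
    by (simp add: K contract_def Let_def)
qed

text \<open>Layers are consecutive blocks of \<open>D\<close> naturals, so vertex \<open>a\<close>
  lies in layer \<open>a div D\<close>. The passage to \<open>int\<close> avoids truncated
  subtraction.\<close>

definition layered_graph :: "nat \<Rightarrow> nat \<Rightarrow> nat ugraph" where
  "layered_graph D m = Ugraph {..<m * D}
     {{a, b} | a b. a < m * D \<and> b < m * D \<and> a \<noteq> b \<and> \<bar>int (a div D) - int (b div D)\<bar> \<le> 1}"

lemma simple_layered_graph:
  assumes "D \<ge> 1" "m \<ge> 1"
  shows "simple_graph (layered_graph D m)"
  using assms by (auto simp: simple_graph_def layered_graph_def lessThan_empty_iff)

lemma layered_graph_edge:
  assumes "{a, b} \<in> edges (layered_graph D m)"
  shows "\<bar>real (a div D) - real (b div D)\<bar> \<le> 1"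
proof -
  have "\<bar>int (a div D) - int (b div D)\<bar> \<le> 1"
    using assms by (auto simp: layered_graph_def doubleton_eq_iff)
  then show ?thesis by linarith
qed

lemma degree_layered_graph:
  assumes "D \<ge> 1" "m \<ge> 2" "v < m * D"
  shows "degree (layered_graph D m) v \<ge> D"
proof -
  define i where "i = v div D"
  \<comment> \<open>A layer next to that of \<open>v\<close>: the one below, or layer 1 if
    \<open>v\<close> lies in layer 0. Layer 1 exists since \<open>m \<ge> 2\<close>.\<close>
  define j where "j = (if i = 0 then 1 else i - 1)"
  have "i < m"
    using assms by (simp add: i_def less_mult_imp_div_less)
  then have j: "j < m" "i \<noteq> j" "\<bar>int i - int j\<bar> \<le> 1"
    using assms(2) by (auto simp: j_def)
  define S where "S = {j * D..<j * D + D}"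
  have S: "u < m * D" "u div D = j" if "u \<in> S" for u
  proof -
    have "j * D + D \<le> m * D"
      using j(1) by (metis Suc_leI add.commute mult_Suc mult_le_mono1)
    then show "u < m * D" using that by (simp add: S_def)
    show "u div D = j"
      using that by (intro div_nat_eqI) (auto simp: S_def mult.commute)
  qed
  \<comment> \<open>Distinct vertices of layer \<open>j\<close> give distinct edges at
    \<open>v\<close>, hence \<open>D\<close> edges.\<close>
  have "inj_on (\<lambda>u. {v, u}) S"
    by (auto simp: inj_on_def doubleton_eq_iff)
  then have "D = card ((\<lambda>u. {v, u}) ` S)"
    by (simp add: card_image S_def)
  also have "\<dots> \<le> card {e \<in> edges (layered_graph D m). v \<in> e}"
  proof (rule card_mono)
    have "edges (layered_graph D m) \<subseteq> Pow {..<m * D}"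
      by (auto simp: layered_graph_def)
    then have "finite (edges (layered_graph D m))"
      by (rule finite_subset) simp
    then show "finite {e \<in> edges (layered_graph D m). v \<in> e}"
      by simp
    show "(\<lambda>u. {v, u}) ` S \<subseteq> {e \<in> edges (layered_graph D m). v \<in> e}"
    proof clarify
      fix u assume "u \<in> S"
      then have "u < m * D" "v \<noteq> u" "\<bar>int (v div D) - int (u div D)\<bar> \<le> 1"
        using S[of u] j by (auto simp: i_def)
      then show "{v, u} \<in> edges (layered_graph D m) \<and> v \<in> {v, u}"
        using assms(3) by (auto simp: layered_graph_def)
    qed
  qed
  finally show ?thesis by (simp add: degree_def)
qed

lemma card_component_layered_graph:
  assumes "D \<ge> 1" "m \<ge> 1" "k \<ge> 1" "contraction_k1 (layered_graph D m) unit_length k C"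
  shows "card (component (Ugraph (verts (layered_graph D m)) C) v) \<le> (k + 1) * D"
\<comment> \<open>The component is empty if \<open>v\<close> is not a vertex; otherwise it has a
  least element.\<close>
proof (cases "component (Ugraph (verts (layered_graph D m)) C) v = {}")
  case False
  let ?A = "component (Ugraph (verts (layered_graph D m)) C) v"
  \<comment> \<open>The least vertex lies in the lowest layer \<open>i\<close> that the component
    meets, so the component lies in layers \<open>i\<close> to \<open>i + k\<close>. Comparing with
    an arbitrary vertex would allow \<open>k\<close> layers on either side, giving only
    \<open>2 * k + 1\<close> layers.\<close>
  define x where "x = (LEAST x. x \<in> ?A)"
  have x: "x \<in> ?A" "\<And>y. y \<in> ?A \<Longrightarrow> x \<le> y"
    using False unfolding x_def by (auto intro: LeastI Least_le)
  define i where "i = x div D"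
  have "?A \<subseteq> {i * D..<i * D + (k + 1) * D}"
  proof
    fix y assume y: "y \<in> ?A"
    have "\<bar>real (y div D) - real (x div D)\<bar> \<le> k"
      using simple_layered_graph[OF assms(1,2)] assms(4,3) layered_graph_edge y x(1)
      by (rule contraction_component_potential)
    then have "y div D < i + k + 1" by (simp add: i_def)
    then have "y < (i + k + 1) * D"
      using assms(1) by (simp add: div_less_iff_less_mult)
    moreover have "i * D \<le> y"
      unfolding i_def using div_times_less_eq_dividend x(2)[OF y] by (rule le_trans)
    ultimately show "y \<in> {i * D..<i * D + (k + 1) * D}"
      by (simp add: algebra_simps)
  qed
  from card_mono[OF _ this] show ?thesis by simp
qed simp

theorem theorem32:
  fixes D k :: nat
  assumes "D \<ge> 1" and "k \<ge> 1"
  shows "\<exists>F :: nat ugraph set.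
    infinite ((\<lambda>G. card (verts G)) ` F) \<and>
    (\<forall>G\<in>F. simple_graph G \<and> min_degree G \<ge> D \<and>
      (\<forall>C. contraction_k1 G unit_length k C \<longrightarrow>
        real (card (verts (contract G C))) \<ge>
          real (card (verts G)) / ((real k + 1) * real D)))"
\<comment> \<open>The family starts at two layers so that every layer has a neighbouring
  one.\<close>
proof (intro exI[of _ "layered_graph D ` {2..}"] conjI ballI allI impI)
  have "(\<lambda>G. card (verts G)) ` layered_graph D ` {2..} = (\<lambda>m. m * D) ` {2..}"
    by (simp add: image_image layered_graph_def)
  moreover have "inj_on (\<lambda>m. m * D) {2..}"
    using assms(1) by (auto simp: inj_on_def)
  ultimately show "infinite ((\<lambda>G. card (verts G)) ` layered_graph D ` {2..})"
    by (simp add: finite_image_iff infinite_Ici)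
next
  fix G assume "G \<in> layered_graph D ` {2..}"
  then obtain m where m: "m \<ge> 2" "G = layered_graph D m" by auto
  show simple: "simple_graph G"
    using simple_layered_graph assms(1) m by simp
  then have fin: "finite (verts G)" "verts G \<noteq> {}"
    by (auto simp: simple_graph_def)
  moreover have "\<forall>v\<in>verts G. degree G v \<ge> D"
    using degree_layered_graph[OF assms(1) m(1)] m(2) by (simp add: layered_graph_def)
  ultimately show "min_degree G \<ge> D"
    by (simp add: min_degree_def)
  fix C assume "contraction_k1 G unit_length k C"
  then have "card (verts G) \<le> card (verts (contract G C)) * ((k + 1) * D)"
    using card_component_layered_graph assms m
    by (intro card_verts_le_contract) auto
  then have "real (card (verts G)) \<le> real (card (verts (contract G C)) * ((k + 1) * D))"
    by (simp only: of_nat_le_iff)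
  then have "real (card (verts G)) \<le> real (card (verts (contract G C))) * ((real k + 1) * real D)"
    by (simp add: algebra_simps)
  then show "real (card (verts (contract G C))) \<ge> real (card (verts G)) / ((real k + 1) * real D)"
    using assms by (simp add: divide_le_eq)
qed

end
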